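(* Let $\Omega$ be a nonempty finite set, let $\operatorname{Sym}(\Omega)$ act on itself by conjugation, and for $g\in\operatorname{Sym}(\Omega)$ let $\psi(g)$ be the digraph $(\Omega,\{(\alpha,\beta)\in\Omega\times\Omega:\alpha^g=\beta\})$. Then $\psi$ is injective and $\operatorname{Sym}(\Omega)$-invariant. Consequently, letting $\mathcal{O}$ be the set of all labelled digraphs on $\Omega$ (graph backtracking): (1) for all $g,h\in\operatorname{Sym}(\Omega)$, the pair of constant functions on $\operatorname{Stacks}(\mathcal{O})$ with images the one-entry stacks $[\sigma(\psi(g))]$ and $[\sigma(\psi(h))]$ is a perfect refiner for $\{x\in\operatorname{Sym}(\Omega):x^{-1}gx=h\}$ (in particular, for $h=g$, for the centraliser of $g$ in $\operatorname{Sym}(\Omega)$); (2) for every subgroup $K=\langle g_1,\dots,g_m\rangle$ of $\operatorname{Sym}(\Omega)$ with $m\geq1$, the pair $(f,f)$, where $f$ is the constant function on $\operatorname{Stacks}(\mathcal{O})$ with image $[\sigma(\psi(g_1)),\dots,\sigma(\psi(g_m))]$, is a perfect refiner for the centraliser of $K$ in $\operatorname{Sym}(\Omega)$.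
   Context: Actions are right actions, written by exponentiation; conjugation is $g^x=x^{-1}gx$. A digraph on a set $V$ is a pair $(V,A)$ with arc set $A \subseteq V\times V$ (loops allowed); a labelled digraph on $V$ additionally has a label assigned to each vertex and each arc. $\operatorname{Sym}(V)$ acts on (labelled) digraphs on $V$ by renaming vertices (carrying labels along). $\sigma$ denotes the function that turns a digraph on $\Omega$ into a labelled digraph by assigning one fixed label to all of its vertices and arcs. A function $f:X\to Y$ between sets on which $\operatorname{Sym}(\Omega)$ acts is $\operatorname{Sym}(\Omega)$-invariant if $f(x^g)=f(x)^g$ for all $x\in X$, $g\in\operatorname{Sym}(\Omega)$. For a set $\mathcal{O}$ on which $\operatorname{Sym}(\Omega)$ acts, $\operatorname{Stacks}(\mathcal{O})$ is the set of all finite lists (including the empty one) with entries in $\mathcal{O}$, acted on entrywise; $|S|$ is length and $\Vert$ is concatenation. $\operatorname{Transp}(x,y) = \{g\in\operatorname{Sym}(\Omega) : x^g=y\}$. A refiner for $U\subseteq\operatorname{Sym}(\Omega)$ (with respect to $\mathcal{O}$) is a pair $(f_L,f_R)$ of functions from $\operatorname{Stacks}(\mathcal{O})$ to itself such that $U\cap\operatorname{Transp}(S,T)\subseteq\operatorname{Transp}(f_L(S),f_R(T))$ for all $S,T$. It is perfect if $U\cap\operatorname{Transp}(S,T)=\operatorname{Transp}(S\Vert f_L(S),\,T\Vert f_R(T))$ for all $S,T$ with $|S|=|T|$. *)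

theory Defs
  imports "HOL-Algebra.Generated_Groups" "HOL-Combinatorics.Permutations" "Graph_Theory.Pair_Digraph"
begin

section \<open>Symmetric groups and right actions\<close>

text \<open>
  Permutations act on the right, so the product \<open>g \<otimes> h\<close> means ``first \<open>g\<close>, then \<open>h\<close>'', and
  \<open>\<alpha>\<^sup>g\<close> is written \<open>g \<alpha>\<close>.
\<close>

definition Sym :: "'a set \<Rightarrow> ('a \<Rightarrow> 'a) monoid" where
  "Sym \<Omega> = \<lparr>carrier = {p. p permutes \<Omega>}, monoid.mult = (\<lambda>g h. h \<circ> g), one = id\<rparr>"

text \<open>An action is a function taking a point and then a group element: \<open>x\<^sup>g\<close> is \<open>act x g\<close>.\<close>

definition right_action ::
    "('g, 'b) monoid_scheme \<Rightarrow> 'x set \<Rightarrow> ('x \<Rightarrow> 'g \<Rightarrow> 'x) \<Rightarrow> bool" where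
  "right_action G X act \<longleftrightarrow>
     (\<forall>x\<in>X. \<forall>g\<in>carrier G. act x g \<in> X) \<and>
     (\<forall>x\<in>X. act x \<one>\<^bsub>G\<^esub> = x) \<and>
     (\<forall>x\<in>X. \<forall>g\<in>carrier G. \<forall>h\<in>carrier G. act x (g \<otimes>\<^bsub>G\<^esub> h) = act (act x g) h)"

definition invariant_map ::
    "('g, 'b) monoid_scheme \<Rightarrow> 'x set \<Rightarrow> ('x \<Rightarrow> 'g \<Rightarrow> 'x) \<Rightarrow> 'y set \<Rightarrow> ('y \<Rightarrow> 'g \<Rightarrow> 'y)
      \<Rightarrow> ('x \<Rightarrow> 'y) \<Rightarrow> bool" where
  "invariant_map G X actX Y actY f \<longleftrightarrow>
     f \<in> X \<rightarrow> Y \<and> (\<forall>x\<in>X. \<forall>g\<in>carrier G. f (actX x g) = actY (f x) g)"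

definition conj_act :: "('g, 'b) monoid_scheme \<Rightarrow> 'g \<Rightarrow> 'g \<Rightarrow> 'g" where
  "conj_act G g x = inv\<^bsub>G\<^esub> x \<otimes>\<^bsub>G\<^esub> g \<otimes>\<^bsub>G\<^esub> x"

definition centraliser :: "('g, 'b) monoid_scheme \<Rightarrow> 'g set \<Rightarrow> 'g set" where
  "centraliser G K = {x \<in> carrier G. \<forall>k\<in>K. k \<otimes>\<^bsub>G\<^esub> x = x \<otimes>\<^bsub>G\<^esub> k}"

definition transporter ::
    "('g, 'b) monoid_scheme \<Rightarrow> ('x \<Rightarrow> 'g \<Rightarrow> 'x) \<Rightarrow> 'x \<Rightarrow> 'x \<Rightarrow> 'g set" where
  "transporter G act x y = {g \<in> carrier G. act x g = y}"


section \<open>Digraphs and labelled digraphs\<close>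

definition digraphs_on :: "'a set \<Rightarrow> 'a pair_pre_digraph set" where
  "digraphs_on V = {D. pair_wf_digraph D \<and> pverts D = V}"

definition digraph_act :: "'a pair_pre_digraph \<Rightarrow> ('a \<Rightarrow> 'a) \<Rightarrow> 'a pair_pre_digraph" where
  "digraph_act D g = \<lparr>pverts = g ` pverts D, parcs = map_prod g g ` parcs D\<rparr>"

text \<open>
  Labels come from an arbitrary type. Labellings are partial maps defined exactly on the vertices
  and exactly on the arcs, so that equality of records is equality of labelled digraphs.
\<close>

record ('a, 'l) labelled_digraph =
  underlying :: "'a pair_pre_digraph"
  vlabel :: "'a \<Rightarrow> 'l option"
  alabel :: "'a \<times> 'a \<Rightarrow> 'l option"

definition labelled_digraphs_on :: "'a set \<Rightarrow> ('a, 'l) labelled_digraph set" where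
  "labelled_digraphs_on V =
     {L. underlying L \<in> digraphs_on V \<and> dom (vlabel L) = V \<and> dom (alabel L) = parcs (underlying L)}"

text \<open>The vertex \<open>v\<^sup>g\<close> of \<open>L\<^sup>g\<close> carries the label that \<open>v\<close> has in \<open>L\<close>; likewise for arcs.\<close>

definition labelled_digraph_act ::
    "('a, 'l) labelled_digraph \<Rightarrow> ('a \<Rightarrow> 'a) \<Rightarrow> ('a, 'l) labelled_digraph" where
  "labelled_digraph_act L g =
     \<lparr>underlying = digraph_act (underlying L) g,
      vlabel = vlabel L \<circ> Hilbert_Choice.inv g,
      alabel = alabel L \<circ> map_prod (Hilbert_Choice.inv g) (Hilbert_Choice.inv g)\<rparr>"

definition const_labelling :: "'l \<Rightarrow> 'a pair_pre_digraph \<Rightarrow> ('a, 'l) labelled_digraph" where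
  "const_labelling c D =
     \<lparr>underlying = D,
      vlabel = (\<lambda>v. if v \<in> pverts D then Some c else None),
      alabel = (\<lambda>e. if e \<in> parcs D then Some c else None)\<rparr>"

definition perm_digraph :: "'a set \<Rightarrow> ('a \<Rightarrow> 'a) \<Rightarrow> 'a pair_pre_digraph" where
  "perm_digraph \<Omega> g = \<lparr>pverts = \<Omega>, parcs = {(\<alpha>, \<beta>). \<alpha> \<in> \<Omega> \<and> \<beta> \<in> \<Omega> \<and> g \<alpha> = \<beta>}\<rparr>"


section \<open>Stacks and refiners\<close>

definition Stacks :: "'x set \<Rightarrow> 'x list set" where
  "Stacks X = lists X"

definition stack_act :: "('x \<Rightarrow> 'g \<Rightarrow> 'x) \<Rightarrow> 'x list \<Rightarrow> 'g \<Rightarrow> 'x list" where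
  "stack_act act S g = map (\<lambda>x. act x g) S"

definition refiner ::
    "('g, 'b) monoid_scheme \<Rightarrow> 'x set \<Rightarrow> ('x \<Rightarrow> 'g \<Rightarrow> 'x) \<Rightarrow> 'g set
      \<Rightarrow> ('x list \<Rightarrow> 'x list) \<times> ('x list \<Rightarrow> 'x list) \<Rightarrow> bool" where
  "refiner G X act U = (\<lambda>(fL, fR).
     U \<subseteq> carrier G \<and> fL \<in> Stacks X \<rightarrow> Stacks X \<and> fR \<in> Stacks X \<rightarrow> Stacks X \<and>
     (\<forall>S\<in>Stacks X. \<forall>T\<in>Stacks X.
        U \<inter> transporter G (stack_act act) S T \<subseteq> transporter G (stack_act act) (fL S) (fR T)))"

definition perfect_refiner ::
    "('g, 'b) monoid_scheme \<Rightarrow> 'x set \<Rightarrow> ('x \<Rightarrow> 'g \<Rightarrow> 'x) \<Rightarrow> 'g set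
      \<Rightarrow> ('x list \<Rightarrow> 'x list) \<times> ('x list \<Rightarrow> 'x list) \<Rightarrow> bool" where
  "perfect_refiner G X act U = (\<lambda>(fL, fR).
     refiner G X act U (fL, fR) \<and>
     (\<forall>S\<in>Stacks X. \<forall>T\<in>Stacks X. length S = length T \<longrightarrow>
        U \<inter> transporter G (stack_act act) S T =
          transporter G (stack_act act) (S @ fL S) (T @ fR T)))"


section \<open>The structures above are a group and right actions\<close>

lemma Sym_simps [simp]:
  "carrier (Sym \<Omega>) = {p. p permutes \<Omega>}" "\<one>\<^bsub>Sym \<Omega>\<^esub> = id" "g \<otimes>\<^bsub>Sym \<Omega>\<^esub> h = h \<circ> g"
  by (simp_all add: Sym_def)

lemma group_Sym: "group (Sym \<Omega>)"
proof (rule groupI)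
  fix x assume "x \<in> carrier (Sym \<Omega>)"
  then show "\<exists>y\<in>carrier (Sym \<Omega>). y \<otimes>\<^bsub>Sym \<Omega>\<^esub> x = \<one>\<^bsub>Sym \<Omega>\<^esub>"
    using permutes_inv permutes_inv_o(1) by fastforce
qed (auto simp: permutes_compose permutes_id comp_assoc)

lemma inv_Sym: "g permutes \<Omega> \<Longrightarrow> inv\<^bsub>Sym \<Omega>\<^esub> g = Hilbert_Choice.inv g"
  by (rule group.inv_equality[OF group_Sym]) (auto simp: permutes_inv permutes_inv_o)

lemma right_action_conj:
  assumes "group G" shows "right_action G (carrier G) (conj_act G)"
proof -
  interpret group G by fact
  show ?thesis
    by (auto simp: right_action_def conj_act_def inv_mult_group m_assoc)
qed

lemma right_action_digraph: "right_action (Sym \<Omega>) (digraphs_on \<Omega>) digraph_act"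
proof -
  have "digraph_act D g \<in> digraphs_on \<Omega>" if "D \<in> digraphs_on \<Omega>" "g permutes \<Omega>" for D g
    using that permutes_in_image[OF that(2)] permutes_image[OF that(2)]
    by (auto simp: digraphs_on_def digraph_act_def pair_wf_digraph_def)
  then show ?thesis
    by (auto simp: right_action_def digraph_act_def image_comp map_prod.comp prod.map_id0)
qed

lemma right_action_labelled_digraph:
  "right_action (Sym \<Omega>) (labelled_digraphs_on \<Omega>) labelled_digraph_act"
proof -
  have *: "x \<in> f ` A \<longleftrightarrow> f' x \<in> A" if "f \<circ> f' = id" "f' \<circ> f = id"
    for f f' :: "'c \<Rightarrow> 'c" and x A
    using that by (metis comp_apply id_apply image_iff)
  have "labelled_digraph_act L g \<in> labelled_digraphs_on \<Omega>"
    if L: "L \<in> labelled_digraphs_on \<Omega>" and g: "g permutes \<Omega>"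
    for L :: "('a, 'l) labelled_digraph" and g
  proof -
    let ?i = "Hilbert_Choice.inv g"
    have o: "g \<circ> ?i = id" "?i \<circ> g = id" using permutes_inv_o[OF g] by auto
    have o2: "map_prod g g \<circ> map_prod ?i ?i = id" "map_prod ?i ?i \<circ> map_prod g g = id"
      by (simp_all add: map_prod.comp o map_prod.id)
    have "digraph_act (underlying L) g \<in> digraphs_on \<Omega>"
      using L g right_action_digraph[of \<Omega>]
      by (auto simp: right_action_def labelled_digraphs_on_def)
    moreover have "dom (vlabel L \<circ> ?i) = \<Omega>"
      using L permutes_in_image[OF permutes_inv[OF g]]
      by (auto simp: labelled_digraphs_on_def dom_def)
    moreover have "dom (alabel L \<circ> map_prod ?i ?i) = map_prod g g ` dom (alabel L)"
    proof (rule Set.set_eqI)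
      fix e
      show "e \<in> dom (alabel L \<circ> map_prod ?i ?i) \<longleftrightarrow> e \<in> map_prod g g ` dom (alabel L)"
        unfolding *[OF o2] dom_def by simp
    qed
    ultimately show ?thesis
      using L by (simp add: labelled_digraphs_on_def labelled_digraph_act_def digraph_act_def)
  qed
  then show ?thesis
    by (auto simp: right_action_def labelled_digraph_act_def digraph_act_def image_comp
        map_prod.comp map_prod.id o_inv_distrib permutes_bij comp_assoc inv_id)
qed

lemma right_action_stack:
  assumes "right_action G X act" shows "right_action G (Stacks X) (stack_act act)"
  using assms by (auto simp: right_action_def Stacks_def stack_act_def in_lists_conv_set
      intro!: map_idI)

end

(*
  A permutation is determined by the arcs of its digraph, and renaming the vertices by x turns the
  digraph of g into that of g^x. Constant labelling is again injective and invariant. For an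
  injective invariant map f, x carries [f g1, ..., f gm] to [f h1, ..., f hm] exactly when it
  carries each gi to hi, and appending such fixed stacks of equal length to S and T adds exactly
  this condition to the transporter of S and T. Taking conjugation as the action, the condition
  for h = g says that x commutes with every gi, that is, with the subgroup they generate.
*)
theory Submission
  imports Defs
begin

text \<open>Acting preserves length, so the moved \<open>S\<close> ends exactly where
  \<open>T\<close> does and equality of the concatenations splits at that point.\<close>

lemma transporter_stack_append:
  assumes "length S = length T"
  shows "transporter G (stack_act act) (S @ A) (T @ B) =
    transporter G (stack_act act) S T \<inter> transporter G (stack_act act) A B"
  using assms by (auto simp: transporter_def stack_act_def)

text \<open>With the transporter of \<open>A\<close> to \<open>B\<close> itself as the refined set,
  the refiner inclusion is immediate and \<open>transporter_stack_append\<close> gives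
  perfection.\<close>

lemma perfect_refiner_const:
  assumes "A \<in> Stacks X" and "B \<in> Stacks X"
  shows "perfect_refiner G X act (transporter G (stack_act act) A B) (\<lambda>S. A, \<lambda>S. B)"
  using assms
  by (auto simp: perfect_refiner_def refiner_def transporter_stack_append)
     (auto simp: transporter_def)

text \<open>Invariance moves \<open>f\<close> outside the action, and injectivity then cancels it
  entrywise.\<close>

lemma transporter_stack_map:
  assumes "right_action G X actX" and "invariant_map G X actX Y actY f" and "inj_on f X"
    and "A \<in> Stacks X" and "B \<in> Stacks X"
  shows "transporter G (stack_act actY) (map f A) (map f B) =
    transporter G (stack_act actX) A B"
proof -
  have "map (\<lambda>x. actY (f x) g) A = map f B \<longleftrightarrow> map (\<lambda>x. actX x g) A = B"
    if g: "g \<in> carrier G" for g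
  proof -
    have "map (\<lambda>x. actY (f x) g) A = map f (map (\<lambda>x. actX x g) A)"
      using assms g by (auto simp: invariant_map_def Stacks_def)
    \<comment> \<open>Injectivity is known only on \<open>X\<close>, so the moved entries of
      \<open>A\<close> must stay there; closure under the action ensures this.\<close>
    moreover have "set (map (\<lambda>x. actX x g) A) \<union> set B \<subseteq> X"
      using assms g by (auto simp: right_action_def Stacks_def)
    then have "inj_on f (set (map (\<lambda>x. actX x g) A) \<union> set B)"
      using \<open>inj_on f X\<close> inj_on_subset by blast
    ultimately show ?thesis
      by (metis map_inj_on)
  qed
  then show ?thesis
    by (auto simp: transporter_def stack_act_def comp_def)
qed

text \<open>Separates the two actions: the refined set is described by the action on
  \<open>X\<close>, while the stacks have entries in \<open>Y\<close>.\<close>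

lemma perfect_refiner_const_map:
  assumes "right_action G X actX" and "invariant_map G X actX Y actY f" and "inj_on f X"
    and "A \<in> Stacks X" and "B \<in> Stacks X"
  shows "perfect_refiner G Y actY (transporter G (stack_act actX) A B)
    (\<lambda>S. map f A, \<lambda>S. map f B)"
proof -
  have "map f A \<in> Stacks Y" "map f B \<in> Stacks Y"
    using assms by (auto simp: invariant_map_def Stacks_def in_lists_conv_set Pi_iff)
  from perfect_refiner_const[OF this, of G actY] show ?thesis
    by (simp add: transporter_stack_map[OF assms])
qed

lemma invariant_map_comp:
  assumes "invariant_map G X actX Y actY f" and "invariant_map G Y actY Z actZ f'"
  shows "invariant_map G X actX Z actZ (f' \<circ> f)"
  using assms by (fastforce simp: invariant_map_def Pi_iff)

context group
begin

lemma conj_act_eq_iff: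
  assumes "g \<in> carrier G" and "x \<in> carrier G"
  shows "conj_act G g x = g \<longleftrightarrow> g \<otimes> x = x \<otimes> g"
  using assms inv_solve_left[of g x "g \<otimes> x"] by (auto simp: conj_act_def m_assoc)

text \<open>Commuting with an element means fixing it under conjugation, and a stack is fixed when
  each entry is.\<close>

lemma centraliser_eq_transporter:
  assumes "set gs \<subseteq> carrier G"
  shows "centraliser G (set gs) = transporter G (stack_act (conj_act G)) gs gs"
proof -
  have "map (\<lambda>g. conj_act G g x) gs = gs \<longleftrightarrow> (\<forall>g\<in>set gs. conj_act G g x = g)" for x
    using map_eq_conv[of "\<lambda>g. conj_act G g x" gs id] by simp
  then show ?thesis
    using assms conj_act_eq_iff by (auto simp: subset_iff centraliser_def transporter_def stack_act_def)
qed

text \<open>For fixed \<open>x\<close>, the elements commuting with \<open>x\<close> include the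
  identity and are closed under inverses and products, which is what induction over
  \<open>generate\<close> asks for.\<close>

lemma centraliser_generate:
  assumes "S \<subseteq> carrier G"
  shows "centraliser G (generate G S) = centraliser G S"
proof
  show "centraliser G (generate G S) \<subseteq> centraliser G S"
    by (auto simp: centraliser_def intro: generate.incl)
next
  have "k \<otimes> x = x \<otimes> k"
    if "k \<in> generate G S" and x: "x \<in> carrier G" and S: "\<forall>s\<in>S. s \<otimes> x = x \<otimes> s" for k x
    using that(1)
  proof induction
    case one
    then show ?case using x by simp
  next
    case (incl h)
    then show ?case using S by blast
  next
    case (inv h)
    then have "h \<in> carrier G" "h \<otimes> x = x \<otimes> h" using assms S by auto
    \<comment> \<open>Associating to the left exposes \<open>h \<otimes> x\<close> for the swap;
      associating back to the right cancels \<open>h\<close> against its inverse.\<close>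
    then have "h \<otimes> (x \<otimes> inv h) = x"
      using x by (simp add: m_assoc[symmetric]) (simp add: m_assoc)
    then show ?case
      using x \<open>h \<in> carrier G\<close> inv_solve_left[of "x \<otimes> inv h" h x] by simp
  next
    case (eng h1 h2)
    then have "h1 \<in> carrier G" "h2 \<in> carrier G"
      using assms generate_in_carrier by blast+
    then have "h1 \<otimes> h2 \<otimes> x = (h1 \<otimes> x) \<otimes> h2"
      using x eng.IH(2) by (simp add: m_assoc)
    then show ?case
      using x \<open>h1 \<in> carrier G\<close> \<open>h2 \<in> carrier G\<close> eng.IH(1) by (simp add: m_assoc)
  qed
  then show "centraliser G S \<subseteq> centraliser G (generate G S)"
    by (auto simp: centraliser_def)
qed

end

text \<open>The only arc leaving a point of \<Omega> ends at its image; outside \<Omega>, where the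
  digraph records nothing, \<open>permutes\<close> makes both maps the identity.\<close>

lemma inj_on_perm_digraph: "inj_on (perm_digraph \<Omega>) (carrier (Sym \<Omega>))"
proof (rule inj_onI)
  fix g h assume gh: "g \<in> carrier (Sym \<Omega>)" "h \<in> carrier (Sym \<Omega>)"
    and eq: "perm_digraph \<Omega> g = perm_digraph \<Omega> h"
  show "g = h"
  proof
    fix \<alpha>
    show "g \<alpha> = h \<alpha>"
    proof (cases "\<alpha> \<in> \<Omega>")
      case True
      then have "(\<alpha>, g \<alpha>) \<in> parcs (perm_digraph \<Omega> g)"
        using gh permutes_in_image by (fastforce simp: perm_digraph_def)
      then show ?thesis unfolding eq by (simp add: perm_digraph_def)
    next
      case False
      then show ?thesis using gh by (simp add: permutes_not_in)
    qed
  qed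
qed

lemma invariant_perm_digraph:
  "invariant_map (Sym \<Omega>) (carrier (Sym \<Omega>)) (conj_act (Sym \<Omega>))
    (digraphs_on \<Omega>) digraph_act (perm_digraph \<Omega>)"
proof -
  have "perm_digraph \<Omega> (conj_act (Sym \<Omega>) g x) = digraph_act (perm_digraph \<Omega> g) x"
    if g: "g permutes \<Omega>" and x: "x permutes \<Omega>" for g x
  proof -
    \<comment> \<open>Products read from left to right, so the conjugate of \<open>g\<close> by
      \<open>x\<close> first applies the inverse of \<open>x\<close>. Its arcs form
      \<open>?A\<close>; the renamed arcs of \<open>g\<close> form \<open>?B\<close>.\<close>
    let ?A = "{(\<alpha>, \<beta>). \<alpha> \<in> \<Omega> \<and> \<beta> \<in> \<Omega> \<and> x (g (Hilbert_Choice.inv x \<alpha>)) = \<beta>}"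
    let ?B = "map_prod x x ` {(\<alpha>, \<beta>). \<alpha> \<in> \<Omega> \<and> \<beta> \<in> \<Omega> \<and> g \<alpha> = \<beta>}"
    have "?A = ?B"
    proof (intro subset_antisym subrelI)
      fix \<alpha> \<beta> assume ab: "(\<alpha>, \<beta>) \<in> ?A"
      \<comment> \<open>The tail pulled back along \<open>x\<close> starts the arc of
        \<open>g\<close> whose renaming is the given arc.\<close>
      let ?a = "Hilbert_Choice.inv x \<alpha>"
      have "?a \<in> \<Omega>" "g ?a \<in> \<Omega>" "(\<alpha>, \<beta>) = map_prod x x (?a, g ?a)"
        using ab g x by (auto simp: permutes_in_image permutes_inv permutes_inverses)
      then show "(\<alpha>, \<beta>) \<in> ?B"
        by blast
    qed (use x in \<open>auto simp: permutes_in_image permutes_inverses\<close>)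
    then show ?thesis
      using x by (simp add: perm_digraph_def digraph_act_def conj_act_def inv_Sym permutes_image)
  qed
  then show ?thesis
    by (auto simp: invariant_map_def digraphs_on_def pair_wf_digraph_def perm_digraph_def)
qed

text \<open>Renaming moves vertex and arc sets by images but labellings by precomposition with the
  inverse; this converts between the two forms.\<close>

lemma mem_image_iff_inverse:
  assumes "\<And>y. f (f' y) = y" and "\<And>x. f' (f x) = x"
  shows "y \<in> f ` A \<longleftrightarrow> f' y \<in> A"
  using assms by (metis imageE imageI)

lemma inj_const_labelling: "inj (const_labelling c)"
  by (rule injI) (simp add: const_labelling_def)

lemma invariant_const_labelling:
  "invariant_map (Sym \<Omega>) (digraphs_on \<Omega>) digraph_act
    (labelled_digraphs_on \<Omega>) labelled_digraph_act (const_labelling c)"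
proof -
  have "const_labelling c (digraph_act D g) = labelled_digraph_act (const_labelling c D) g"
    if "g permutes \<Omega>" for D g
  proof -
    let ?i = "Hilbert_Choice.inv g"
    have g: "g (?i v) = v" "?i (g v) = v" for v
      using that by (simp_all add: permutes_inverses)
    have "v \<in> g ` V \<longleftrightarrow> ?i v \<in> V" for v V
      using g by (rule mem_image_iff_inverse)
    moreover have "e \<in> map_prod g g ` E \<longleftrightarrow> map_prod ?i ?i e \<in> E" for e E
      by (rule mem_image_iff_inverse) (auto simp: g prod_eq_iff)
    \<comment> \<open>\<open>map_prod\<close> stays folded, the form in which the arc equivalence is
      stated.\<close>
    ultimately show ?thesis
      by (simp add: const_labelling_def labelled_digraph_act_def digraph_act_def fun_eq_iff
          del: map_prod_simp)
  qed
  moreover have "const_labelling c \<in> digraphs_on \<Omega> \<rightarrow> labelled_digraphs_on \<Omega>"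
    by (auto simp: labelled_digraphs_on_def digraphs_on_def const_labelling_def dom_def
        split: if_splits)
  ultimately show ?thesis
    by (simp add: invariant_map_def)
qed

theorem mainTheorem8:
  fixes \<Omega> :: "'a set" and c :: 'l
  assumes "finite \<Omega>" and "\<Omega> \<noteq> {}"
  defines "G \<equiv> Sym \<Omega>"
    and "\<psi> \<equiv> perm_digraph \<Omega>"
    and "\<sigma> \<equiv> (const_labelling c :: 'a pair_pre_digraph \<Rightarrow> ('a, 'l) labelled_digraph)"
    and "\<O> \<equiv> (labelled_digraphs_on \<Omega> :: ('a, 'l) labelled_digraph set)"
  shows "inj_on \<psi> (carrier G) \<and>
    invariant_map G (carrier G) (conj_act G) (digraphs_on \<Omega>) digraph_act \<psi> \<and>
    (\<forall>g\<in>carrier G. \<forall>h\<in>carrier G.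
      perfect_refiner G \<O> labelled_digraph_act
        {x \<in> carrier G. inv\<^bsub>G\<^esub> x \<otimes>\<^bsub>G\<^esub> g \<otimes>\<^bsub>G\<^esub> x = h}
        (\<lambda>S. [\<sigma> (\<psi> g)], \<lambda>S. [\<sigma> (\<psi> h)])) \<and>
    (\<forall>g\<in>carrier G.
      perfect_refiner G \<O> labelled_digraph_act (centraliser G {g})
        (\<lambda>S. [\<sigma> (\<psi> g)], \<lambda>S. [\<sigma> (\<psi> g)])) \<and>
    (\<forall>K gs. subgroup K G \<longrightarrow> gs \<noteq> [] \<longrightarrow> set gs \<subseteq> carrier G \<longrightarrow> K = generate G (set gs) \<longrightarrow>
      perfect_refiner G \<O> labelled_digraph_act (centraliser G K)
        (\<lambda>S. map (\<lambda>g. \<sigma> (\<psi> g)) gs, \<lambda>S. map (\<lambda>g. \<sigma> (\<psi> g)) gs))"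
proof -
  interpret group G
    unfolding G_def by (rule group_Sym)
  define f where "f = \<sigma> \<circ> \<psi>"
  have inj: "inj_on \<psi> (carrier G)"
    unfolding \<psi>_def G_def by (rule inj_on_perm_digraph)
  have inv: "invariant_map G (carrier G) (conj_act G) (digraphs_on \<Omega>) digraph_act \<psi>"
    unfolding \<psi>_def G_def by (rule invariant_perm_digraph)
  have f_inj: "inj_on f (carrier G)"
    unfolding f_def \<sigma>_def
    by (intro comp_inj_on inj inj_on_subset[OF inj_const_labelling]) simp
  have f_inv: "invariant_map G (carrier G) (conj_act G) \<O> labelled_digraph_act f"
    unfolding f_def
    by (rule invariant_map_comp[OF inv])
      (auto simp: G_def \<sigma>_def \<O>_def intro: invariant_const_labelling)
  \<comment> \<open>All refiner claims are instances of this: stacks of permutations under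
    conjugation, encoded by \<open>f\<close>.\<close>
  note refiner = perfect_refiner_const_map[OF right_action_conj[OF is_group] f_inv f_inj]
  have conj: "perfect_refiner G \<O> labelled_digraph_act
      {x \<in> carrier G. inv\<^bsub>G\<^esub> x \<otimes>\<^bsub>G\<^esub> g \<otimes>\<^bsub>G\<^esub> x = h} (\<lambda>S. [\<sigma> (\<psi> g)], \<lambda>S. [\<sigma> (\<psi> h)])"
    if "g \<in> carrier G" "h \<in> carrier G" for g h
    using refiner[of "[g]" "[h]"] that
    by (simp add: Stacks_def transporter_def stack_act_def conj_act_def f_def)
  \<comment> \<open>Treats the generators only; \<open>centraliser_generate\<close> passes to
    \<open>K\<close> at the end.\<close>
  have cent: "perfect_refiner G \<O> labelled_digraph_act (centraliser G (set gs))
      (\<lambda>S. map (\<lambda>g. \<sigma> (\<psi> g)) gs, \<lambda>S. map (\<lambda>g. \<sigma> (\<psi> g)) gs)"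
    if "set gs \<subseteq> carrier G" for gs
    using refiner[of gs gs] that
    by (simp add: Stacks_def in_lists_conv_set subset_iff centraliser_eq_transporter f_def comp_def)
  have "perfect_refiner G \<O> labelled_digraph_act (centraliser G {g})
      (\<lambda>S. [\<sigma> (\<psi> g)], \<lambda>S. [\<sigma> (\<psi> g)])" if "g \<in> carrier G" for g
    using cent[of "[g]"] that by simp
  then show ?thesis
    using inj inv conj cent centraliser_generate by simp
qed

end
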